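(* The elliptic numbers $[x]_{a,b;q,p}$ are continuously strongly log-concave in the following sense: for all real numbers $q,p,x,y,r,a,b$ satisfying $0<q<1$, $0<p<q^{2r}$, $x\ge y\ge r\ge 0$, and $pq^{-x-r}<a<b<1$ (and such that the denominators in the definition of the elliptic numbers involved do not vanish), we have $$[x]_{a,b;q,p}\,[y]_{a,b;q,p}\ \ge\ [x+r]_{a,b;q,p}\,[y-r]_{a,b;q,p}.$$
   Context: For $|p|<1$ and $z\ne 0$ the modified Jacobi theta function is $\theta(z;p):=\prod_{j\ge 0}(1-zp^j)(1-p^{j+1}/z)$, and $\theta(z_1,\dots,z_s;p):=\theta(z_1;p)\cdots\theta(z_s;p)$. The elliptic number (or $a,b;q,p$-number) of $x$ is $$[x]_{a,b;q,p}:=\frac{\theta(q^x,\,aq^x,\,bq,\,aq/b;p)}{\theta(q,\,aq,\,bq^x,\,aq^x/b;p)}.$$ *)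

theory Defs
  imports "HOL-Analysis.Analysis"
begin

text \<open>The modified Jacobi theta function; meaningful for \<open>norm p < 1\<close> and \<open>z \<noteq> 0\<close>.\<close>

definition jtheta :: "'a::real_normed_field \<Rightarrow> 'a \<Rightarrow> 'a" where
  "jtheta z p = (\<Prod>j. (1 - z * p ^ j) * (1 - p ^ (j + 1) / z))"

definition jthetas :: "'a::real_normed_field list \<Rightarrow> 'a \<Rightarrow> 'a" where
  "jthetas zs p = (\<Prod>z\<leftarrow>zs. jtheta z p)"

text \<open>Elliptic numbers for real parameters with \<open>q > 0\<close>, so that \<open>q powr x\<close> is the usual
  real power.\<close>

definition elliptic_denom :: "real \<Rightarrow> real \<Rightarrow> real \<Rightarrow> real \<Rightarrow> real \<Rightarrow> real" where
  "elliptic_denom a b q p x = jthetas [q, a * q, b * q powr x, a * q powr x / b] p"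

definition elliptic_number :: "real \<Rightarrow> real \<Rightarrow> real \<Rightarrow> real \<Rightarrow> real \<Rightarrow> real" where
  "elliptic_number a b q p x =
     jthetas [q powr x, a * q powr x, b * q, a * q / b] p / elliptic_denom a b q p x"

end

theory Submission
  imports Defs
begin

text \<open>
  Put \<open>c = a / b\<close> and \<open>g w = (1 - w) (1 - b c w) / ((1 - b w) (1 - c w))\<close>. Up to a factor that does
  not depend on \<open>x\<close>, the elliptic number of \<open>x\<close> is the infinite product of
  \<open>g (z p\<^sup>j) g (p\<^sup>j\<^sup>+\<^sup>1 / (a z))\<close> with \<open>z = q\<^sup>x\<close>, and all these arguments of \<open>g\<close> lie in \<open>(0, 1]\<close>. Since
  \<open>ln (g w) = - (\<Sum>n\<ge>1. w\<^sup>n (1 - b\<^sup>n) (1 - c\<^sup>n) / n)\<close> and every \<open>w\<^sup>n\<close> is convex in \<open>ln w\<close>, the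
  function \<open>g\<close> is log-concave in \<open>ln w\<close>; the inequality then holds factor by factor.
\<close>

section \<open>The factor \<open>g\<close> (here \<open>cross_factor\<close>) and its log-concavity
  in \<open>ln w\<close>\<close>

definition cross_factor :: "real \<Rightarrow> real \<Rightarrow> real \<Rightarrow> real" where
  "cross_factor b c w = (1 - w) * (1 - b * c * w) / ((1 - b * w) * (1 - c * w))"

lemma less_one_mult:
  fixes b w :: real
  assumes "0 < b" "b < 1" "0 < w" "w \<le> 1"
  shows "b * w < 1"
  using mult_left_le[of w b] assms by linarith

lemma cross_factor_pos:
  assumes "0 < b" "b < 1" "0 < c" "c < 1" "0 < w" "w < 1"
  shows "0 < cross_factor b c w"
proof -
  have "b * c < 1" "0 < b * c"
    using assms less_one_mult[of b c] by auto
  then have "b * w < 1" "c * w < 1" "b * c * w < 1"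
    using assms less_one_mult by auto
  then show ?thesis
    using assms by (simp add: cross_factor_def)
qed

text \<open>The end point \<open>w = 1\<close>, where the factor vanishes, has to be included: it is
  reached by \<open>q powr (y - r)\<close> when \<open>y = r\<close>.\<close>

lemma cross_factor_nonneg:
  assumes "0 < b" "b < 1" "0 < c" "c < 1" "0 < w" "w \<le> 1"
  shows "0 \<le> cross_factor b c w"
proof (cases "w = 1")
  case True
  then show ?thesis
    by (simp add: cross_factor_def)
next
  case False
  then have "0 < cross_factor b c w"
    using assms by (intro cross_factor_pos) auto
  then show ?thesis
    by simp
qed

text \<open>The four logarithm series combine through
  \<open>1 - b^n - c^n + (b c)^n = (1 - b^n) (1 - c^n)\<close>. Summation starts at
  \<open>n = 0\<close>, where the term is 0.\<close>

lemma ln_cross_factor_sums: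
  assumes "0 < b" "b < 1" "0 < c" "c < 1" "0 < w" "w < 1"
  shows "(\<lambda>n. - (w ^ n * ((1 - b ^ n) * (1 - c ^ n)) / n)) sums ln (cross_factor b c w)"
proof -
  have bc: "b * c < 1" "0 < b * c"
    using assms less_one_mult[of b c] by auto
  then have lt: "b * w < 1" "c * w < 1" "b * c * w < 1"
    using assms less_one_mult by auto
  have S: "(\<lambda>n. - (t ^ n / n)) sums ln (1 - t)" if "0 < t" "t < 1" for t :: real
    using ln_series'[of "- t"] that by simp
  have "ln (cross_factor b c w)
      = (ln (1 - w) + ln (1 - b * c * w)) - (ln (1 - b * w) + ln (1 - c * w))"
    using assms lt by (simp add: cross_factor_def ln_div ln_mult)
  moreover have "(\<lambda>n. (- (w ^ n / n) + - ((b * c * w) ^ n / n))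
        - (- ((b * w) ^ n / n) + - ((c * w) ^ n / n)))
      sums ((ln (1 - w) + ln (1 - b * c * w)) - (ln (1 - b * w) + ln (1 - c * w)))"
    using assms lt bc by (intro sums_diff sums_add S) auto
  moreover have "(- (w ^ n / n) + - ((b * c * w) ^ n / n))
        - (- ((b * w) ^ n / n) + - ((c * w) ^ n / n))
      = - (w ^ n * ((1 - b ^ n) * (1 - c ^ n)) / n)" for n :: nat
    by (cases "n = 0") (auto simp: field_simps power_mult_distrib)
  ultimately show ?thesis
    by simp
qed

text \<open>Convexity of exp in two-point form: \<open>u * s\<close> and \<open>v / s\<close> have
  the same product as \<open>u\<close> and \<open>v\<close> but lie further apart. The difference of
  the two sums factors as \<open>(1 - s) * (v / s - u)\<close>.\<close>

lemma add_le_spread: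
  fixes u v s :: real
  assumes "0 \<le> u" "u \<le> v" "0 < s" "s \<le> 1"
  shows "u + v \<le> u * s + v / s"
proof -
  have "v * s \<le> v"
    using assms by (intro mult_left_le) auto
  then have "v \<le> v / s"
    using assms by (simp add: field_simps)
  then have "u \<le> v / s"
    using assms by linarith
  then have "0 \<le> (1 - s) * (v / s - u)"
    using assms by simp
  also have "\<dots> = u * s + v / s - (u + v)"
    using assms by (simp add: field_simps)
  finally show ?thesis
    by simp
qed

lemma cross_factor_log_concave:
  assumes bc: "0 < b" "b < 1" "0 < c" "c < 1"
    and uv: "0 < u" "u \<le> v" and r: "0 < r" "r \<le> 1" "v \<le> r"
  shows "cross_factor b c (u * r) * cross_factor b c (v / r) \<le> cross_factor b c u * cross_factor b c v"
proof (cases "v = r")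
  \<comment> \<open>Here \<open>v / r = 1\<close> is the zero of the factor, outside the range of
    the logarithm series; the left side vanishes.\<close>
  case True
  have "0 \<le> cross_factor b c u" "0 \<le> cross_factor b c v"
    using uv r by (auto intro!: cross_factor_nonneg bc)
  then show ?thesis
    using True r by (simp add: cross_factor_def[of b c 1])
next
  case False
  have "0 < v" "v / r < 1" "v < 1" "u < 1"
    using uv r False by auto
  moreover have "u * r < 1"
    using uv r \<open>u < 1\<close> by (metis mult.commute mult_left_le less_imp_le order_le_less_trans)
  ultimately have
    dom: "0 < u * r" "u * r < 1" "0 < v / r" "v / r < 1" "0 < u" "u < 1" "0 < v" "v < 1"
    using uv r by auto
  note pos = cross_factor_pos[OF bc dom(1,2)] cross_factor_pos[OF bc dom(3,4)]
    cross_factor_pos[OF bc dom(5,6)] cross_factor_pos[OF bc dom(7,8)]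
  note S = ln_cross_factor_sums[OF bc]
  have "ln (cross_factor b c (u * r)) + ln (cross_factor b c (v / r))
      \<le> ln (cross_factor b c u) + ln (cross_factor b c v)"
  proof (rule sums_le[OF _ sums_add[OF S[OF dom(1,2)] S[OF dom(3,4)]]
        sums_add[OF S[OF dom(5,6)] S[OF dom(7,8)]]])
    fix n :: nat
    define K where "K = (1 - b ^ n) * (1 - c ^ n) / n"
    have "0 \<le> K"
      using bc by (auto simp: K_def power_le_one)
    \<comment> \<open>The spreading inequality for n-th powers, with ratio \<open>r ^ n\<close>; the
      minus sign in front of each series term then reverses it.\<close>
    moreover have "u ^ n + v ^ n \<le> u ^ n * r ^ n + v ^ n / r ^ n"
      using uv r by (intro add_le_spread) (auto intro: power_mono power_le_one)
    ultimately have "(u ^ n + v ^ n) * K \<le> ((u * r) ^ n + (v / r) ^ n) * K"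
      by (simp add: mult_right_mono power_mult_distrib power_divide)
    then show "- ((u * r) ^ n * ((1 - b ^ n) * (1 - c ^ n)) / n)
          + - ((v / r) ^ n * ((1 - b ^ n) * (1 - c ^ n)) / n)
        \<le> - (u ^ n * ((1 - b ^ n) * (1 - c ^ n)) / n)
          + - (v ^ n * ((1 - b ^ n) * (1 - c ^ n)) / n)"
      by (simp add: K_def distrib_right add_divide_distrib)
  qed
  then have "ln (cross_factor b c (u * r) * cross_factor b c (v / r))
      \<le> ln (cross_factor b c u * cross_factor b c v)"
    using pos by (simp add: ln_mult)
  then show ?thesis
    using pos by (simp only: ln_le_cancel_iff mult_pos_pos)
qed

section \<open>Theta functions and theta quotients as limits of finite products\<close>

lemma jtheta_LIMSEQ:
  fixes z p :: real
  assumes "0 < p" "p < 1"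
  shows "(\<lambda>n. \<Prod>j\<le>n. (1 - z * p ^ j) * (1 - p ^ (j + 1) / z)) \<longlonglongrightarrow> jtheta z p"
proof -
  \<comment> \<open>Both kinds of theta factor have this shape, with \<open>k = z\<close> and
    \<open>k = p / z\<close>.\<close>
  have C: "convergent_prod (\<lambda>j. 1 - k * p ^ j)" for k :: real
  proof -
    have "summable (\<lambda>j. \<bar>k\<bar> * p ^ j)"
      using assms by (intro summable_mult summable_geometric) auto
    then have "summable (\<lambda>j. norm ((1 - k * p ^ j) - 1))"
      using assms by (simp add: abs_mult)
    then show ?thesis
      by (intro abs_convergent_prod_imp_convergent_prod) (simp only: abs_convergent_prod_conv_summable)
  qed
  have "convergent_prod (\<lambda>j. (1 - z * p ^ j) * (1 - p / z * p ^ j))"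
    by (intro convergent_prod_mult C)
  then have "convergent_prod (\<lambda>j. (1 - z * p ^ j) * (1 - p ^ (j + 1) / z))"
    by simp
  then show ?thesis
    unfolding jtheta_def by (rule convergent_prod_LIMSEQ)
qed

text \<open>For each index \<open>j\<close> the eight factors of the four thetas regroup into two
  values of \<open>cross_factor\<close>; since the limits of the denominators are nonzero, the limit
  passes through the quotient.\<close>

lemma theta_quotient_LIMSEQ:
  assumes p: "0 < p" "p < 1" and nz: "0 < a" "0 < b" "0 < z"
    and den: "jtheta (b * z) p \<noteq> 0" "jtheta (a * z / b) p \<noteq> 0"
  shows "(\<lambda>n. \<Prod>j\<le>n. cross_factor b (a / b) (z * p ^ j) * cross_factor b (a / b) (p ^ (j + 1) / (a * z)))
    \<longlonglongrightarrow> jtheta z p * jtheta (a * z) p / (jtheta (b * z) p * jtheta (a * z / b) p)"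
proof -
  define t where "t = (\<lambda>z j. (1 - z * p ^ j) * (1 - p ^ (j + 1) / z))"
  have L: "(\<lambda>n. \<Prod>j\<le>n. t w j) \<longlonglongrightarrow> jtheta w p" for w
    unfolding t_def by (rule jtheta_LIMSEQ[OF p])
  have "(\<lambda>n. (\<Prod>j\<le>n. t z j) * (\<Prod>j\<le>n. t (a * z) j)
        / ((\<Prod>j\<le>n. t (b * z) j) * (\<Prod>j\<le>n. t (a * z / b) j)))
      \<longlonglongrightarrow> jtheta z p * jtheta (a * z) p / (jtheta (b * z) p * jtheta (a * z / b) p)"
    using den by (intro tendsto_divide tendsto_mult L) auto
  moreover have "t z j * t (a * z) j / (t (b * z) j * t (a * z / b) j)
      = cross_factor b (a / b) (z * p ^ j) * cross_factor b (a / b) (p ^ (j + 1) / (a * z))" for j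
  proof -
    \<comment> \<open>In terms of \<open>w\<close> the reciprocal arguments of the four thetas are
      \<open>b c w\<close>, \<open>w\<close>, \<open>c w\<close> and \<open>b w\<close> with
      \<open>c = a / b\<close>, again the pattern of \<open>cross_factor\<close>.\<close>
    define w where "w = p ^ (j + 1) / (a * z)"
    have "p ^ (j + 1) / z = b * (a / b) * w" "p ^ (j + 1) / (a * z) = w"
      "p ^ (j + 1) / (b * z) = a / b * w" "p ^ (j + 1) / (a * z / b) = b * w"
      using nz by (auto simp: w_def)
    moreover have "a * z * p ^ j = b * (a / b) * (z * p ^ j)"
      "a * z / b * p ^ j = a / b * (z * p ^ j)" "b * z * p ^ j = b * (z * p ^ j)"
      using nz by auto
    ultimately show ?thesis
      unfolding t_def cross_factor_def by (simp only: times_divide_times_eq mult_ac)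
  qed
  ultimately show ?thesis
    by (simp add: prod.distrib[symmetric] prod_dividef[symmetric])
qed

text \<open>With \<open>X\<close>, \<open>Y\<close>, \<open>R\<close> the powers of \<open>q\<close>
  with exponents \<open>x\<close>, \<open>y\<close>, \<open>r\<close>, passing to
  \<open>X * R\<close> and \<open>Y / R\<close> spreads both families of arguments. The inequality
  for each index survives finite products and the limit.\<close>

lemma theta_quotient_log_concave:
  fixes a b p X Y R :: real
  defines "F \<equiv> \<lambda>z. jtheta z p * jtheta (a * z) p / (jtheta (b * z) p * jtheta (a * z / b) p)"
  assumes p: "0 < p" and ab: "a < b" "b < 1"
    and X: "0 < X" "X \<le> Y" "Y \<le> R" "R \<le> 1" and a: "p < a * (X * R)"
    and den: "\<And>z. z \<in> {X, Y, X * R, Y / R} \<Longrightarrow> jtheta (b * z) p \<noteq> 0 \<and> jtheta (a * z / b) p \<noteq> 0"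
  shows "F (X * R) * F (Y / R) \<le> F X * F Y"
proof -
  have R: "0 < R" "0 < Y"
    using X by auto
  have "0 < a * (X * R)"
    using p a by linarith
  then have a0: "0 < a"
    using X R by (intro zero_less_mult_pos2[of a "X * R"]) auto
  have "X * R \<le> 1"
    using X R by (simp add: mult_le_one)
  then have "a * (X * R) < 1"
    using a0 ab X R by (intro less_one_mult) auto
  then have p1: "p < 1"
    using a by linarith
  define h where "h = cross_factor b (a / b)"
  define G where "G = (\<lambda>z j. h (z * p ^ j) * h (p ^ (j + 1) / (a * z)))"
  have bc: "0 < b" "b < 1" "0 < a / b" "a / b < 1"
    using a0 ab by auto
  have L: "(\<lambda>n. \<Prod>j\<le>n. G z j) \<longlonglongrightarrow> F z" if "z \<in> {X, Y, X * R, Y / R}" for z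
    unfolding G_def F_def h_def using that den X R a0 bc p p1
    by (intro theta_quotient_LIMSEQ) auto
  have step: "0 \<le> G (X * R) j * G (Y / R) j \<and> G (X * R) j * G (Y / R) j \<le> G X j * G Y j" for j
  proof -
    define P where "P = p ^ j"
    have P: "0 < P" "P \<le> 1"
      using p p1 by (auto simp: P_def power_le_one)
    \<comment> \<open>The map from \<open>z\<close> to \<open>p ^ (j + 1) / (a * z)\<close> reverses
      order, so the smaller argument \<open>u\<close> comes from \<open>Y\<close> and the larger
      \<open>v\<close> from \<open>X\<close>.\<close>
    define u v where "u = P * p / (a * Y)" and "v = P * p / (a * X)"
    have uv: "0 < u" "u \<le> v"
      using P p a0 X R by (auto simp: u_def v_def intro!: divide_left_mono)
    have "v = P * (p / (a * X))"
      by (simp add: v_def)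
    also have "\<dots> \<le> p / (a * X)"
      using P p a0 X by (intro mult_left_le_one_le) auto
    \<comment> \<open>The lower bound on \<open>a\<close> enters here: it keeps the spread argument
      \<open>v / R\<close> at most 1.\<close>
    also have "\<dots> \<le> R"
      using a a0 X by (simp add: field_simps)
    finally have vR: "v \<le> R" .
    have YP: "Y * P \<le> R"
      using X R P by (meson mult_right_le_one_le order_trans less_imp_le)
    have XP: "0 < X * P" "X * P \<le> Y * P"
      using X P by auto
    have G: "G X j = h (X * P) * h v" "G Y j = h (Y * P) * h u"
      "G (X * R) j = h (X * P * R) * h (v / R)" "G (Y / R) j = h (Y * P / R) * h (u * R)"
      by (simp_all add: G_def P_def u_def v_def mult_ac)
    have 1: "h (X * P * R) * h (Y * P / R) \<le> h (X * P) * h (Y * P)"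
      unfolding h_def using XP YP X R by (intro cross_factor_log_concave bc) auto
    have 2: "h (u * R) * h (v / R) \<le> h u * h v"
      unfolding h_def using uv vR X R by (intro cross_factor_log_concave bc) auto
    have nn: "0 \<le> h w" if "0 < w" "w \<le> 1" for w
      unfolding h_def using that by (intro cross_factor_nonneg bc)
    have le1: "s * R \<le> 1" if "0 < s" "s \<le> R" for s
      using that X R by (intro mult_le_one) auto
    have 3: "0 \<le> h (X * P * R) * h (Y * P / R)" "0 \<le> h (u * R) * h (v / R)"
      using XP YP R uv vR by (auto intro!: mult_nonneg_nonneg nn le1)
    have "0 \<le> h (X * P * R) * h (Y * P / R) * (h (u * R) * h (v / R))"
      using 3 by simp
    moreover have "h (X * P * R) * h (Y * P / R) * (h (u * R) * h (v / R))
        \<le> h (X * P) * h (Y * P) * (h u * h v)"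
      by (rule mult_mono[OF 1 2 order_trans[OF 3(1) 1] 3(2)])
    ultimately show ?thesis
      unfolding G by (simp add: mult_ac)
  qed
  have "(\<lambda>n. (\<Prod>j\<le>n. G (X * R) j) * (\<Prod>j\<le>n. G (Y / R) j)) \<longlonglongrightarrow> F (X * R) * F (Y / R)"
    by (intro tendsto_mult L) auto
  moreover have "(\<lambda>n. (\<Prod>j\<le>n. G X j) * (\<Prod>j\<le>n. G Y j)) \<longlonglongrightarrow> F X * F Y"
    by (intro tendsto_mult L) auto
  moreover have "(\<Prod>j\<le>n. G (X * R) j) * (\<Prod>j\<le>n. G (Y / R) j)
      \<le> (\<Prod>j\<le>n. G X j) * (\<Prod>j\<le>n. G Y j)" for n
    \<comment> \<open>Multiplying the inequalities over \<open>j\<close> relies on the nonnegativity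
      of the smaller sides, which is why \<open>step\<close> records it.\<close>
    unfolding prod.distrib[symmetric] using step by (intro prod_mono) auto
  ultimately show ?thesis
    by (intro LIMSEQ_le) auto
qed

section \<open>From theta quotients to elliptic numbers\<close>

theorem theorem14:
  fixes q p x y r a b :: real
  assumes "0 < q" and "q < 1"
    and "0 < p" and "p < q powr (2 * r)"
    and "x \<ge> y" and "y \<ge> r" and "r \<ge> 0"
    and "p * q powr (- x - r) < a" and "a < b" and "b < 1"
    and "elliptic_denom a b q p x \<noteq> 0"
    and "elliptic_denom a b q p y \<noteq> 0"
    and "elliptic_denom a b q p (x + r) \<noteq> 0"
    and "elliptic_denom a b q p (y - r) \<noteq> 0"
  shows "elliptic_number a b q p x * elliptic_number a b q p y
           \<ge> elliptic_number a b q p (x + r) * elliptic_number a b q p (y - r)"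
proof -
  define F where
    "F = (\<lambda>z. jtheta z p * jtheta (a * z) p / (jtheta (b * z) p * jtheta (a * z / b) p))"
  define C where
    "C = jtheta (b * q) p * jtheta (a * q / b) p / (jtheta q p * jtheta (a * q) p)"
  have E: "elliptic_number a b q p s = C * F (q powr s)" for s
    by (simp add: elliptic_number_def elliptic_denom_def jthetas_def C_def F_def mult_ac)
  have pw: "q powr (x + r) = q powr x * q powr r" "q powr (y - r) = q powr y / q powr r"
    by (simp_all add: powr_add powr_diff)
  have "p * q powr (- x - r) * q powr (x + r) = p"
    using assms(1) by (simp add: powr_add[symmetric])
  moreover have "p * q powr (- x - r) * q powr (x + r) < a * q powr (x + r)"
    using assms(1,8) by simp
  ultimately have "p < a * (q powr x * q powr r)"
    unfolding pw by linarith
  moreover have "0 < q powr x" "q powr x \<le> q powr y" "q powr y \<le> q powr r" "q powr r \<le> 1"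
    using assms by (auto intro: powr_mono' simp: powr_le1)
  moreover have "jtheta (b * z) p \<noteq> 0 \<and> jtheta (a * z / b) p \<noteq> 0"
    if "z \<in> {q powr x, q powr y, q powr x * q powr r, q powr y / q powr r}" for z
    using that assms(11-14) unfolding elliptic_denom_def jthetas_def pw by auto
  ultimately have "F (q powr x * q powr r) * F (q powr y / q powr r) \<le> F (q powr x) * F (q powr y)"
    unfolding F_def using assms by (intro theta_quotient_log_concave) auto
  \<comment> \<open>Each elliptic number contributes one \<open>C\<close>, so both sides carry its
    square and the inequality is preserved whatever the sign of \<open>C\<close>.\<close>
  then have "C\<^sup>2 * (F (q powr x * q powr r) * F (q powr y / q powr r))
      \<le> C\<^sup>2 * (F (q powr x) * F (q powr y))"
    by (intro mult_left_mono) auto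
  then show ?thesis
    unfolding E pw by (simp add: power2_eq_square mult_ac)
qed

end
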